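(* Let $(p_n)_{n\ge2}$ and $(q_n)_{n\ge2}$ be real sequences with $0<q_n<p_n\le1$ such that $p_nq_n([n]_{p_n,q_n}-1)>p_n^{n}(p_n-q_n)$ for every $n\ge2$, and such that $$st\text{-}\lim_n q_n=1,\quad st\text{-}\lim_n p_n=1,\quad st\text{-}\lim_n q_n^n=1,\quad st\text{-}\lim_n p_n^n=1.$$ Let $L^*_n(f;p_n;q_n;x)$ be the King type modified $(p,q)$-Lupaş Bernstein operators defined in the context. Then for every $f\in C[0,1]$, every $n\ge2$ and every $x\in[0,1]$, $$|L^*_n(f;p_n;q_n;x)-f(x)|\le 2\,w\!\left(f;\sqrt{\delta_{n,x}}\right),$$ where $\delta_{n,x}=L^*_n((t-x)^2;p_n;q_n;x)$, i.e. the operator $L^*_n$ applied to the function $t\mapsto(t-x)^2$ and evaluated at $x$.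
   Context: For $n\in\mathbb N$, $[n]_{p,q}=p^{n-1}+p^{n-2}q+\dots+pq^{n-2}+q^{n-1}$, $[0]_{p,q}=0$, $[n]_{p,q}!=[1]_{p,q}[2]_{p,q}\cdots[n]_{p,q}$, $[0]_{p,q}!=1$, and $\binom{n}{k}_{p,q}=\frac{[n]_{p,q}!}{[k]_{p,q}!\,[n-k]_{p,q}!}$ for $0\le k\le n$. For $n\ge2$ and $0<q<p\le1$ with $pq([n]_{p,q}-1)>p^n(p-q)$, writing $[m]=[m]_{p,q}$, put for $x\in[0,1]$ $$r_n(x)=\frac{-\left(p^n+x^2[n](p-q)\right)+\sqrt{p^{2n}+x^4[n]^2(p-q)^2+2x^2[n]\left(2pq([n]-1)-p^n(p-q)\right)}}{2\left(p^{n-1}q-p^n+q^2[n-1]\right)},$$ which satisfies $0\le r_n(x)\le 1$. For $f\in C[0,1]$ and $x\in[0,1]$, $$L^*_n(f;p;q;x)=\sum_{k=0}^n \frac{f\!\left(\frac{p^{n-k}[k]_{p,q}}{[n]_{p,q}}\right)\binom{n}{k}_{p,q}p^{\frac{(n-k)(n-k-1)}2}q^{\frac{k(k-1)}2}r_n(x)^k(1-r_n(x))^{n-k}}{\prod_{j=0}^{n-1}\{p^{j}(1-r_n(x))+q^{j}r_n(x)\}}.$$ When $p=p_n$, $q=q_n$, the function $r_n$ is formed with $p_n,q_n$. The modulus of continuity of $f\in C[0,1]$ is $w(f;\delta)=\sup\{|f(t)-f(x)|: x,t\in[0,1],\ |t-x|<\delta\}$ for $\delta>0$, and $w(f;0)=0$.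 A real sequence $(x_k)$ is statistically convergent to $L$, written $st\text{-}\lim_k x_k=L$, if for every $\varepsilon>0$ the set $\{k:|x_k-L|\ge\varepsilon\}$ has natural density $0$, where the density of $K\subseteq\mathbb N$ is $\lim_n \frac1n|\{k\le n:k\in K\}|$ whenever the limit exists. *)

theory Defs
  imports Complex_Main
begin

definition pq_int :: "real \<Rightarrow> real \<Rightarrow> nat \<Rightarrow> real" where
  "pq_int p q n = (\<Sum>i<n. p ^ (n - 1 - i) * q ^ i)"

definition pq_fact :: "real \<Rightarrow> real \<Rightarrow> nat \<Rightarrow> real" where
  "pq_fact p q n = (\<Prod>i=1..n. pq_int p q i)"

definition pq_binomial :: "real \<Rightarrow> real \<Rightarrow> nat \<Rightarrow> nat \<Rightarrow> real" where
  "pq_binomial p q n k = pq_fact p q n / (pq_fact p q k * pq_fact p q (n - k))"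

definition king_r :: "nat \<Rightarrow> real \<Rightarrow> real \<Rightarrow> real \<Rightarrow> real" where
  "king_r n p q x =
    (- (p ^ n + x\<^sup>2 * pq_int p q n * (p - q))
       + sqrt (p ^ (2 * n) + x ^ 4 * (pq_int p q n)\<^sup>2 * (p - q)\<^sup>2
               + 2 * x\<^sup>2 * pq_int p q n
                   * (2 * p * q * (pq_int p q n - 1) - p ^ n * (p - q))))
    / (2 * (p ^ (n - 1) * q - p ^ n + q\<^sup>2 * pq_int p q (n - 1)))"

text \<open>In the exponents the product of consecutive numbers is even, so \<open>div 2\<close> is exact, and for
  \<open>m = 0\<close> the truncated \<open>m * (m - 1)\<close> has the intended value 0.\<close>

definition king_lupas :: "nat \<Rightarrow> (real \<Rightarrow> real) \<Rightarrow> real \<Rightarrow> real \<Rightarrow> real \<Rightarrow> real" where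
  "king_lupas n f p q x =
    (let r = king_r n p q x in
      \<Sum>k=0..n.
        f (p ^ (n - k) * pq_int p q k / pq_int p q n) * pq_binomial p q n k
          * p ^ ((n - k) * (n - k - 1) div 2) * q ^ (k * (k - 1) div 2)
          * r ^ k * (1 - r) ^ (n - k)
        / (\<Prod>j<n. p ^ j * (1 - r) + q ^ j * r))"

text \<open>The strict inequality makes the case \<open>\<delta> = 0\<close> a separate convention (the set would be empty).\<close>

definition modulus_cont :: "(real \<Rightarrow> real) \<Rightarrow> real \<Rightarrow> real" where
  "modulus_cont f \<delta> =
    (if \<delta> > 0
     then Sup {\<bar>f t - f x\<bar> | t x. t \<in> {0..1} \<and> x \<in> {0..1} \<and> \<bar>t - x\<bar> < \<delta>}
     else 0)"

text \<open>Indices are counted from 1, and finitely many of them do not affect the density; so for a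
  sequence indexed by \<open>k \<ge> 2\<close> the values at 0 and 1 are irrelevant.\<close>

definition has_natural_density :: "nat set \<Rightarrow> real \<Rightarrow> bool" where
  "has_natural_density K d \<longleftrightarrow> (\<lambda>n. real (card {k \<in> {1..n}. k \<in> K}) / real n) \<longlonglongrightarrow> d"

definition stat_tendsto :: "(nat \<Rightarrow> real) \<Rightarrow> real \<Rightarrow> bool" where
  "stat_tendsto x L \<longleftrightarrow> (\<forall>\<epsilon>>0. has_natural_density {k. \<bar>x k - L\<bar> \<ge> \<epsilon>} 0)"

end

theory Submission
  imports Defs
begin

text \<open>The operator averages \<open>f\<close> over nodes in \<open>[0,1]\<close> with weights that are nonnegative, because
  \<open>0 \<le> r\<^sub>n(x) \<le> 1\<close>, and that sum to \<open>1\<close> by the \<open>(p,q)\<close>-binomial theorem. The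
  estimate is then the classical one: averaging
  \<open>\<bar>f t - f x\<bar> \<le> (1 + (t - x)\<^sup>2 / \<delta>\<^sup>2) w(f; \<delta>)\<close> with
  \<open>\<delta>\<^sup>2 = L\<^sup>*\<^sub>n((t - x)\<^sup>2; x)\<close> gives the factor \<open>2\<close>. If \<open>\<delta> = 0\<close>, every
  node of positive weight equals \<open>x\<close>, so both sides vanish.\<close>

section \<open>Arithmetic of \<open>(p,q)\<close>-integers and \<open>(p,q)\<close>-binomial
  coefficients\<close>

lemma pq_int_0 [simp]: "pq_int p q 0 = 0"
  by (simp add: pq_int_def)

lemma pq_int_Suc: "pq_int p q (Suc n) = p ^ n + q * pq_int p q n"
  by (simp add: pq_int_def sum.lessThan_Suc_shift sum_distrib_left mult_ac del: sum.lessThan_Suc)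

lemma pq_int_mult_diff: "pq_int p q n * (p - q) = p ^ n - q ^ n"
proof (induction n)
  case (Suc n)
  have "pq_int p q (Suc n) * (p - q) = p ^ n * (p - q) + q * (pq_int p q n * (p - q))"
    by (simp add: pq_int_Suc algebra_simps)
  then show ?case
    by (simp add: Suc.IH) (simp add: algebra_simps)
qed simp

text \<open>After multiplication by \<open>p - q\<close> every \<open>(p,q)\<close>-integer becomes
  a difference of powers, and the middle terms \<open>p ^ m * q ^ n\<close> cancel. Both the Pascal
  rule and the location of the nodes rest on this splitting.\<close>

lemma pq_int_add:
  assumes "p \<noteq> q"
  shows "pq_int p q (m + n) = p ^ m * pq_int p q n + q ^ n * pq_int p q m"
proof -
  have "pq_int p q (m + n) * (p - q) = (p ^ m * pq_int p q n + q ^ n * pq_int p q m) * (p - q)"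
    by (simp add: distrib_right mult.assoc pq_int_mult_diff) (simp add: power_add algebra_simps)
  with assms show ?thesis
    by simp
qed

lemma pq_int_nonneg: "0 \<le> p \<Longrightarrow> 0 \<le> q \<Longrightarrow> 0 \<le> pq_int p q n"
  by (simp add: pq_int_def sum_nonneg)

lemma pq_int_pos: "0 < p \<Longrightarrow> 0 < q \<Longrightarrow> 0 < n \<Longrightarrow> 0 < pq_int p q n"
  by (auto simp: pq_int_def intro!: sum_pos)

lemma pq_fact_0 [simp]: "pq_fact p q 0 = 1"
  by (simp add: pq_fact_def)

lemma pq_fact_Suc: "pq_fact p q (Suc n) = pq_int p q (Suc n) * pq_fact p q n"
  by (simp add: pq_fact_def mult.commute)

lemma pq_fact_pos: "0 < p \<Longrightarrow> 0 < q \<Longrightarrow> 0 < pq_fact p q n"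
  by (auto simp: pq_fact_def intro!: prod_pos pq_int_pos)

lemma pq_binomial_nonneg: "0 < p \<Longrightarrow> 0 < q \<Longrightarrow> 0 \<le> pq_binomial p q n k"
  by (simp add: pq_binomial_def pq_fact_pos less_imp_le)

lemma pq_binomial_n_0: "0 < p \<Longrightarrow> 0 < q \<Longrightarrow> pq_binomial p q n 0 = 1"
  using pq_fact_pos[of p q n] by (simp add: pq_binomial_def)

lemma pq_binomial_n_n: "0 < p \<Longrightarrow> 0 < q \<Longrightarrow> pq_binomial p q n n = 1"
  using pq_fact_pos[of p q n] by (simp add: pq_binomial_def)

text \<open>Pascal rule, from splitting the leading factor \<open>pq_int p q (Suc n)\<close> of the
  numerator. At \<open>k = n\<close> it would break: truncated subtraction makes
  \<open>pq_binomial p q n (Suc n)\<close> nonzero.\<close>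

lemma pq_binomial_Suc_Suc:
  assumes pq: "0 < p" "0 < q" "p \<noteq> q" and k: "k < n"
  shows "pq_binomial p q (Suc n) (Suc k) =
    p ^ Suc k * pq_binomial p q n (Suc k) + q ^ (n - k) * pq_binomial p q n k"
proof -
  obtain m where n: "n = Suc k + m"
    using less_imp_Suc_add[OF k] by auto
  define I J F G H where "I = pq_int p q (Suc k)" and "J = pq_int p q (Suc m)"
    and "F = pq_fact p q n" and "G = pq_fact p q k" and "H = pq_fact p q m"
  have pos: "I > 0" "J > 0" "F > 0" "G > 0" "H > 0"
    using pq by (simp_all add: I_def J_def F_def G_def H_def pq_int_pos pq_fact_pos)
  have split: "pq_int p q (Suc n) = p ^ Suc k * J + q ^ Suc m * I"
    using pq_int_add[OF pq(3), of "Suc k" "Suc m"] by (simp add: n I_def J_def)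
  have "pq_binomial p q (Suc n) (Suc k) = (p ^ Suc k * J + q ^ Suc m * I) * F / ((I * G) * (J * H))"
    by (simp add: pq_binomial_def pq_fact_Suc[of p q n] split)
      (simp add: n pq_fact_Suc F_def G_def H_def I_def J_def)
  moreover have "pq_binomial p q n (Suc k) = F / (I * G * H)"
    by (simp add: pq_binomial_def n pq_fact_Suc F_def G_def H_def I_def)
  moreover have "pq_binomial p q n k = F / (G * (J * H))"
    by (simp add: pq_binomial_def n pq_fact_Suc F_def G_def H_def J_def)
  moreover have "n - k = Suc m"
    by (simp add: n)
  ultimately show ?thesis
    using pos by (simp add: add_divide_distrib distrib_right)
qed

section \<open>The \<open>(p,q)\<close>-binomial theorem\<close>

lemma triangular_Suc: "Suc m * (Suc m - 1) div 2 = m + m * (m - 1) div 2"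
proof -
  have "Suc m * (Suc m - 1) = 2 * m + m * (m - 1)"
    by (cases m) (simp_all add: algebra_simps)
  then show ?thesis
    by simp
qed

text \<open>With the triangular powers absorbed, the factors in the Pascal rule become
  \<open>p ^ n\<close> and \<open>q ^ n\<close>, independent of \<open>k\<close>.\<close>

definition pq_coeff :: "real \<Rightarrow> real \<Rightarrow> nat \<Rightarrow> nat \<Rightarrow> real" where
  "pq_coeff p q n k =
    pq_binomial p q n k * p ^ ((n - k) * (n - k - 1) div 2) * q ^ (k * (k - 1) div 2)"

lemma pq_coeff_Suc_0:
  assumes "0 < p" "0 < q"
  shows "pq_coeff p q (Suc n) 0 = p ^ n * pq_coeff p q n 0"
  using assms triangular_Suc[of n] by (simp add: pq_coeff_def pq_binomial_n_0 power_add)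

lemma pq_coeff_Suc_Suc_diag:
  assumes "0 < p" "0 < q"
  shows "pq_coeff p q (Suc n) (Suc n) = q ^ n * pq_coeff p q n n"
  using assms triangular_Suc[of n] by (simp add: pq_coeff_def pq_binomial_n_n power_add)

text \<open>With \<open>m = n - Suc k\<close>, the triangular exponents of \<open>p\<close> and
  \<open>q\<close> grow by \<open>m\<close> and \<open>k\<close>. These increments complete the
  Pascal factors \<open>p ^ Suc k\<close> and \<open>q ^ Suc m\<close> to \<open>p ^ n\<close> and
  \<open>q ^ n\<close>.\<close>

lemma pq_coeff_Suc_Suc:
  assumes pq: "0 < p" "0 < q" "p \<noteq> q" and k: "k < n"
  shows "pq_coeff p q (Suc n) (Suc k) = p ^ n * pq_coeff p q n (Suc k) + q ^ n * pq_coeff p q n k"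
proof -
  obtain m where n: "n = Suc k + m"
    using less_imp_Suc_add[OF k] by auto
  have d: "Suc n - Suc k = Suc m" "n - Suc k = m" "n - k = Suc m"
    by (simp_all add: n)
  have P: "p ^ n = p ^ Suc k * p ^ m" and Q: "q ^ n = q ^ Suc m * q ^ k"
    by (simp_all add: n power_add)
  show ?thesis
    unfolding pq_coeff_def pq_binomial_Suc_Suc[OF assms] d triangular_Suc power_add P Q
    by (simp add: algebra_simps)
qed

theorem pq_binomial_theorem:
  assumes pq: "0 < p" "0 < q" "p \<noteq> q"
  shows "(\<Sum>k=0..n. pq_coeff p q n k * b ^ k * a ^ (n - k)) = (\<Prod>j<n. p ^ j * a + q ^ j * b)"
proof (induction n)
  case 0
  show ?case
    using pq by (simp add: pq_coeff_def pq_binomial_n_0)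
next
  case (Suc n)
  let ?c = "pq_coeff p q"
  let ?s = "\<lambda>k. ?c n k * b ^ k * a ^ (n - k)"
  have mid: "?c (Suc n) (Suc k) * b ^ Suc k * a ^ (Suc n - Suc k)
      = p ^ n * a * ?s (Suc k) + q ^ n * b * ?s k" if "k < n" for k
  proof -
    have "a ^ (n - k) = a * a ^ (n - Suc k)"
      using that by (metis Suc_diff_Suc power_Suc)
    then show ?thesis
      by (simp add: pq_coeff_Suc_Suc[OF pq that] algebra_simps)
  qed
  \<comment> \<open>The two end terms are split off, since the Pascal rule covers only the interior.
    Regrouping then yields the old sum times the new factor
    \<open>p ^ n * a + q ^ n * b\<close>.\<close>
  have "(\<Sum>k=0..Suc n. ?c (Suc n) k * b ^ k * a ^ (Suc n - k))
      = ?c (Suc n) 0 * a ^ Suc n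
        + (\<Sum>k<n. ?c (Suc n) (Suc k) * b ^ Suc k * a ^ (Suc n - Suc k))
        + ?c (Suc n) (Suc n) * b ^ Suc n"
    unfolding atLeast0AtMost sum.atMost_Suc_shift
    by (simp add: lessThan_Suc_atMost[symmetric])
  also have "\<dots> = p ^ n * a * ?s 0 + (\<Sum>k<n. p ^ n * a * ?s (Suc k) + q ^ n * b * ?s k)
      + q ^ n * b * ?s n"
  proof (intro arg_cong2[where f = plus] sum.cong refl)
    show "?c (Suc n) (Suc k) * b ^ Suc k * a ^ (Suc n - Suc k)
        = p ^ n * a * ?s (Suc k) + q ^ n * b * ?s k" if "k \<in> {..<n}" for k
      using mid that by blast
  qed (use pq in \<open>simp_all add: pq_coeff_Suc_0 pq_coeff_Suc_Suc_diag\<close>)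
  also have "\<dots> = p ^ n * a * (?s 0 + (\<Sum>k<n. ?s (Suc k))) + q ^ n * b * ((\<Sum>k<n. ?s k) + ?s n)"
    by (simp only: sum.distrib sum_distrib_left[symmetric] distrib_left add_ac)
  also have "?s 0 + (\<Sum>k<n. ?s (Suc k)) = sum ?s {0..n}"
    by (simp add: atLeast0AtMost lessThan_Suc_atMost[symmetric] sum.lessThan_Suc_shift
        del: sum.lessThan_Suc)
  also have "(\<Sum>k<n. ?s k) + ?s n = sum ?s {0..n}"
    by (simp add: atLeast0AtMost lessThan_Suc_atMost[symmetric])
  finally show ?case
    unfolding Suc.IH by (simp add: algebra_simps)
qed

section \<open>Nodes and \<open>king_r\<close> lie in the unit interval\<close>

lemma pq_node_in_unit_interval:
  assumes pq: "0 < p" "0 < q" "p \<noteq> q" and kn: "k \<le> n" "0 < n"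
  shows "p ^ (n - k) * pq_int p q k / pq_int p q n \<in> {0..1}"
proof -
  \<comment> \<open>The numerator of the node is one of two nonnegative summands of its
    denominator.\<close>
  have "pq_int p q n = p ^ (n - k) * pq_int p q k + q ^ k * pq_int p q (n - k)"
    using pq_int_add[OF pq(3), of "n - k" k] kn by simp
  moreover have "0 \<le> q ^ k * pq_int p q (n - k)" "0 \<le> p ^ (n - k) * pq_int p q k"
    using pq by (simp_all add: pq_int_nonneg)
  ultimately show ?thesis
    using pq_int_pos[OF pq(1,2) kn(2)] by simp
qed

text \<open>In the notation of the proof, \<open>s = D * r\<close> is the nonnegative root of
  \<open>s\<^sup>2 + B * s = E\<close>. Hence \<open>0 \<le> r\<close> follows from
  \<open>E \<ge> 0\<close>, and \<open>r \<le> 1\<close> from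
  \<open>E \<le> D * (D + B)\<close>.\<close>

lemma king_r_bounds:
  assumes pq: "0 < q" "q < p" "p \<le> 1" and n: "n \<ge> 1"
    and cond: "p * q * (pq_int p q n - 1) > p ^ n * (p - q)"
    and x: "0 \<le> x" "x \<le> 1"
  shows "king_r n p q x \<in> {0..1}"
proof -
  obtain m where m: "n = Suc m"
    using n by (cases n) auto
  define N where "N = pq_int p q n"
  define D where "D = q * N - p ^ n"
  define B where "B = p ^ n + x\<^sup>2 * N * (p - q)"
  define C where "C = p * q * (N - 1) - p ^ n * (p - q)"
  define E where "E = x\<^sup>2 * N * C"
  have N: "N > 0"
    using pq n by (simp add: N_def pq_int_pos)
  have pn: "p ^ n \<le> p"
    using power_decreasing[of 1 n p] pq n by simp
  have C: "C > 0"
    using cond by (simp add: C_def N_def)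
  have CD: "C = p * D - q * (p - p ^ n)"
    by (simp add: C_def D_def algebra_simps)
  have D: "D > 0"
  proof -
    have "0 \<le> q * (p - p ^ n)"
      using pn pq by simp
    then have "p * D > 0"
      using C CD by linarith
    then show ?thesis
      using pq by (simp add: zero_less_mult_iff)
  qed
  have denom: "p ^ (n - 1) * q - p ^ n + q\<^sup>2 * pq_int p q (n - 1) = D"
    by (simp add: D_def N_def m pq_int_Suc algebra_simps power2_eq_square)
  have radicand: "p ^ (2 * n) + x ^ 4 * N\<^sup>2 * (p - q)\<^sup>2
      + 2 * x\<^sup>2 * N * (2 * p * q * (N - 1) - p ^ n * (p - q)) = B\<^sup>2 + 4 * E"
  proof -
    have "p ^ (2 * n) = (p ^ n)\<^sup>2" "x ^ 4 = (x\<^sup>2)\<^sup>2"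
      by (simp_all add: power_mult[symmetric] mult.commute)
    then show ?thesis
      unfolding B_def E_def C_def by (simp only:) (simp add: power2_eq_square algebra_simps)
  qed
  have r: "king_r n p q x = (- B + sqrt (B\<^sup>2 + 4 * E)) / (2 * D)"
    unfolding king_r_def denom N_def[symmetric] radicand by (simp add: B_def)
  have B: "B \<ge> 0"
    using pq N by (simp add: B_def)
  have "E \<ge> 0"
    using N C by (simp add: E_def)
  then have "sqrt (B\<^sup>2 + 4 * E) \<ge> B"
    by (intro real_le_rsqrt) simp
  moreover have "sqrt (B\<^sup>2 + 4 * E) \<le> 2 * D + B"
  proof (rule real_le_lsqrt)
    have x2: "x\<^sup>2 \<le> 1"
      using x by (simp add: power_le_one)
    \<comment> \<open>Here \<open>D + B = N * (q + x\<^sup>2 * (p - q))\<close>, so \<open>N\<close>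
      factors out, and \<open>CD\<close> leaves only nonnegative terms.\<close>
    have "D * (D + B) - E = N * ((1 - x\<^sup>2) * (q * D) + x\<^sup>2 * (q * (p - p ^ n)))"
      by (simp add: E_def CD B_def) (simp add: D_def algebra_simps)
    also have "\<dots> \<ge> 0"
      using N D pn pq x2 by simp
    finally show "B\<^sup>2 + 4 * E \<le> (2 * D + B)\<^sup>2"
      by (simp add: power2_eq_square algebra_simps)
  qed (use D B in simp)
  ultimately show ?thesis
    using D by (simp add: r)
qed

section \<open>Modulus of continuity and weighted averages\<close>

lemma abs_diff_le_modulus_cont:
  assumes f: "continuous_on {0..1} f" and "t \<in> {0..1}" "x \<in> {0..1}" "\<bar>t - x\<bar> < \<delta>"
  shows "\<bar>f t - f x\<bar> \<le> modulus_cont f \<delta>"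
proof -
  let ?S = "{\<bar>f t - f x\<bar> | t x. t \<in> {0..1} \<and> x \<in> {0..1} \<and> \<bar>t - x\<bar> < \<delta>}"
  obtain u where u: "\<forall>y\<in>{0..1}. f y \<le> f u"
    using continuous_attains_sup[OF compact_Icc _ f] by auto
  obtain l where l: "\<forall>y\<in>{0..1}. f l \<le> f y"
    using continuous_attains_inf[OF compact_Icc _ f] by auto
  have "\<bar>f s - f y\<bar> \<le> f u - f l" if "s \<in> {0..1}" "y \<in> {0..1}" for s y
    using u l that by (smt (verit, best))
  \<comment> \<open>A real \<open>Sup\<close> is an upper bound only for a set that is bounded
    above; compactness of the interval supplies the bound.\<close>
  then have "bdd_above ?S"
    by (intro bdd_aboveI[of _ "f u - f l"]) blast
  then have "\<bar>f t - f x\<bar> \<le> Sup ?S"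
    using assms by (intro cSup_upper) blast+
  moreover have "\<delta> > 0"
    using assms(4) by linarith
  ultimately show ?thesis
    by (simp only: modulus_cont_def if_True)
qed

text \<open>The strict inequality in the modulus forces \<open>\<lfloor>\<lambda>\<rfloor> + 1\<close> subintervals
  rather than \<open>\<lceil>\<lambda>\<rceil>\<close>, where \<open>\<lambda> = \<bar>t - x\<bar> / \<delta>\<close>.\<close>

lemma abs_diff_le_modulus_cont_quadratic:
  assumes f: "continuous_on {0..1} f" and t: "t \<in> {0..1}" and x: "x \<in> {0..1}" and \<delta>: "\<delta> > 0"
  shows "\<bar>f t - f x\<bar> \<le> (1 + (t - x)\<^sup>2 / \<delta>\<^sup>2) * modulus_cont f \<delta>"
proof -
  define w where "w = modulus_cont f \<delta>"
  define l where "l = \<bar>t - x\<bar> / \<delta>"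
  have w: "w \<ge> 0"
    using abs_diff_le_modulus_cont[OF f x x] \<delta> by (simp add: w_def)
  have l0: "l \<ge> 0"
    using \<delta> by (simp add: l_def)
  have l2: "(t - x)\<^sup>2 / \<delta>\<^sup>2 = l\<^sup>2"
    by (simp add: l_def power_divide)
  show ?thesis
  proof (cases "l < 1")
    case True
    then have "\<bar>f t - f x\<bar> \<le> w"
      unfolding w_def using \<delta> by (intro abs_diff_le_modulus_cont[OF f t x]) (simp add: l_def)
    also have "w \<le> (1 + l\<^sup>2) * w"
      using w by (simp add: distrib_right)
    finally show ?thesis
      by (simp add: l2 w_def)
  next
    case False
    define m where "m = nat \<lfloor>l\<rfloor> + 1"
    have m: "l < m" "m \<le> 1 + l" "m > 0"
      using l0 unfolding m_def by linarith+
    \<comment> \<open>Equally spaced points from \<open>x\<close> to \<open>t\<close>; as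
      \<open>m > l\<close>, neighbours are less than \<open>\<delta>\<close> apart.\<close>
    define y where "y i = x + (i / m) * (t - x)" for i :: nat
    have y01: "y i \<in> {0..1}" if "i \<le> m" for i
    proof -
      define a where "a = real i / real m"
      have a: "0 \<le> a" "a \<le> 1"
        using that m by (simp_all add: a_def)
      have "(1 - a) * x \<le> 1 - a" "a * t \<le> a" "0 \<le> (1 - a) * x" "0 \<le> a * t"
        using a t x by (simp_all add: mult_left_le)
      moreover have "y i = (1 - a) * x + a * t"
        by (simp add: y_def a_def[symmetric] algebra_simps)
      ultimately show ?thesis
        by (simp only: atLeastAtMost_iff) linarith
    qed
    have step: "\<bar>f (y (Suc i)) - f (y i)\<bar> \<le> w" if "i < m" for i
      unfolding w_def
    proof (rule abs_diff_le_modulus_cont[OF f y01 y01])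
      have "y (Suc i) - y i = (t - x) / m"
        using m by (simp add: y_def field_simps)
      then have "\<bar>y (Suc i) - y i\<bar> = \<bar>t - x\<bar> / m"
        by simp
      also have "\<dots> < \<delta>"
        using m \<delta> by (simp add: l_def field_simps)
      finally show "\<bar>y (Suc i) - y i\<bar> < \<delta>" .
    qed (use that in simp_all)
    have "f t - f x = (\<Sum>i<m. f (y (Suc i)) - f (y i))"
      unfolding sum_lessThan_telescope[of "\<lambda>i. f (y i)"] using m by (simp add: y_def)
    also have "\<bar>\<dots>\<bar> \<le> (\<Sum>i<m. \<bar>f (y (Suc i)) - f (y i)\<bar>)"
      by (rule sum_abs)
    also have "\<dots> \<le> m * w"
      using sum_bounded_above[of "{..<m}" "\<lambda>i. \<bar>f (y (Suc i)) - f (y i)\<bar>" w] step by simp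
    \<comment> \<open>In this case \<open>l \<ge> 1\<close>, so
      \<open>m \<le> 1 + l \<le> 1 + l\<^sup>2\<close>.\<close>
    also have "\<dots> \<le> (1 + l\<^sup>2) * w"
      using m False w self_le_power[of l 2] by (intro mult_right_mono) auto
    finally show ?thesis
      by (simp add: l2 w_def)
  qed
qed

text \<open>The analytic core, separated from the particular operator: only a probability
  distribution on \<open>[0,1]\<close> with second moment about \<open>x\<close> enters.\<close>

lemma weighted_mean_approximation:
  assumes f: "continuous_on {0..1} f" and x: "x \<in> {0..1}"
    and t: "\<And>k. k \<in> K \<Longrightarrow> t k \<in> {0..1}"
    and w: "\<And>k. k \<in> K \<Longrightarrow> 0 \<le> w k" and w1: "sum w K = 1"
  shows "\<bar>(\<Sum>k\<in>K. f (t k) * w k) - f x\<bar>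
    \<le> 2 * modulus_cont f (sqrt (\<Sum>k\<in>K. (t k - x)\<^sup>2 * w k))"
proof -
  define V where "V = (\<Sum>k\<in>K. (t k - x)\<^sup>2 * w k)"
  \<comment> \<open>Over an infinite set \<open>sum\<close> defaults to \<open>0\<close>,
    contradicting total weight \<open>1\<close>.\<close>
  have fin: "finite K"
    using w1 by (metis sum.infinite zero_neq_one)
  have V0: "V \<ge> 0"
    unfolding V_def using w by (intro sum_nonneg) simp
  have diff: "(\<Sum>k\<in>K. f (t k) * w k) - f x = (\<Sum>k\<in>K. (f (t k) - f x) * w k)"
    using w1 by (simp add: left_diff_distrib sum_subtractf flip: sum_distrib_left)
  show ?thesis
  proof (cases "V = 0")
    case True
    then have "\<forall>k\<in>K. (t k - x)\<^sup>2 * w k = 0"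
      unfolding V_def using w fin by (subst (asm) sum_nonneg_eq_0_iff) auto
    \<comment> \<open>In each term either \<open>t k = x\<close> or \<open>w k = 0\<close>.\<close>
    then have "(\<Sum>k\<in>K. (f (t k) - f x) * w k) = 0"
      by (intro sum.neutral) auto
    then show ?thesis
      using True by (simp add: diff modulus_cont_def V_def)
  next
    case False
    then have V: "V > 0"
      using V0 by simp
    define M where "M = modulus_cont f (sqrt V)"
    have "\<bar>\<Sum>k\<in>K. (f (t k) - f x) * w k\<bar> \<le> (\<Sum>k\<in>K. \<bar>(f (t k) - f x) * w k\<bar>)"
      by (rule sum_abs)
    also have "\<dots> \<le> (\<Sum>k\<in>K. (1 + (t k - x)\<^sup>2 / V) * M * w k)"
    proof (rule sum_mono)
      fix k assume k: "k \<in> K"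
      have "\<bar>f (t k) - f x\<bar> \<le> (1 + (t k - x)\<^sup>2 / V) * M"
        using abs_diff_le_modulus_cont_quadratic[OF f t[OF k] x, of "sqrt V"] V
        by (simp add: M_def)
      then show "\<bar>(f (t k) - f x) * w k\<bar> \<le> (1 + (t k - x)\<^sup>2 / V) * M * w k"
        using w[OF k] by (simp add: abs_mult mult_right_mono)
    qed
    also have "\<dots> = M * (sum w K + (\<Sum>k\<in>K. (t k - x)\<^sup>2 * w k) / V)"
      by (simp add: sum_distrib_left sum_divide_distrib sum.distrib[symmetric] algebra_simps)
    \<comment> \<open>The choice \<open>\<delta> = sqrt V\<close> makes the second moment over
      \<open>\<delta>\<^sup>2\<close> equal to \<open>1\<close>, giving
      \<open>1 + 1\<close>.\<close>
    also have "\<dots> = 2 * M"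
      using V w1 by (simp flip: V_def)
    finally show ?thesis
      by (simp add: diff M_def V_def)
  qed
qed

theorem theorem4p1:
  fixes p q :: "nat \<Rightarrow> real"
  assumes "\<And>n. n \<ge> 2 \<Longrightarrow> 0 < q n \<and> q n < p n \<and> p n \<le> 1"
    and "\<And>n. n \<ge> 2 \<Longrightarrow> p n * q n * (pq_int (p n) (q n) n - 1) > p n ^ n * (p n - q n)"
    and "stat_tendsto q 1"
    and "stat_tendsto p 1"
    and "stat_tendsto (\<lambda>n. q n ^ n) 1"
    and "stat_tendsto (\<lambda>n. p n ^ n) 1"
  shows "\<forall>f :: real \<Rightarrow> real. continuous_on {0..1} f \<longrightarrow>
    (\<forall>n\<ge>2. \<forall>x\<in>{0..1}.
      \<bar>king_lupas n f (p n) (q n) x - f x\<bar>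
        \<le> 2 * modulus_cont f (sqrt (king_lupas n (\<lambda>t. (t - x)\<^sup>2) (p n) (q n) x)))"
proof (intro allI impI ballI)
  fix f :: "real \<Rightarrow> real" and n :: nat and x :: real
  assume f: "continuous_on {0..1} f" and n: "2 \<le> n" and x: "x \<in> {0..1}"
  define P Q r where "P = p n" and "Q = q n" and "r = king_r n P Q x"
  have PQ: "0 < Q" "Q < P" "P \<le> 1"
    using assms(1)[OF n] by (simp_all add: P_def Q_def)
  have r: "0 \<le> r" "r \<le> 1"
    using king_r_bounds[OF PQ, of n x] assms(2)[OF n] n x by (auto simp: P_def Q_def r_def)
  define t where "t k = P ^ (n - k) * pq_int P Q k / pq_int P Q n" for k
  define Z where "Z = (\<Prod>j<n. P ^ j * (1 - r) + Q ^ j * r)"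
  define w where "w k = pq_coeff P Q n k * r ^ k * (1 - r) ^ (n - k) / Z" for k
  \<comment> \<open>Stated for every \<open>g\<close>, so that \<open>f\<close> and the squared
    distance to \<open>x\<close> are averaged with the same weights.\<close>
  have eq: "king_lupas n g (p n) (q n) x = (\<Sum>k=0..n. g (t k) * w k)" for g
    by (simp add: king_lupas_def Let_def t_def w_def Z_def pq_coeff_def r_def P_def Q_def mult.assoc)
  have Z: "Z > 0"
    unfolding Z_def
  proof (rule prod_pos)
    fix j
    show "0 < P ^ j * (1 - r) + Q ^ j * r"
    \<comment> \<open>At least one of \<open>r\<close> and \<open>1 - r\<close> is positive; the
      second summand gives strict positivity unless \<open>r = 0\<close>.\<close>
    proof (cases "r = 0")
      case False
      then show ?thesis
        using PQ r by (intro add_nonneg_pos) simp_all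
    qed (use PQ in simp)
  qed
  have "sum w {0..n} = (\<Sum>k=0..n. pq_coeff P Q n k * r ^ k * (1 - r) ^ (n - k)) / Z"
    by (simp add: w_def sum_divide_distrib)
  also have "\<dots> = 1"
    \<comment> \<open>With \<open>a = 1 - r\<close> and \<open>b = r\<close> the binomial product is
      exactly \<open>Z\<close>.\<close>
    using PQ Z by (subst pq_binomial_theorem) (simp_all flip: Z_def)
  finally have w1: "sum w {0..n} = 1" .
  have w0: "0 \<le> w k" for k
    using PQ r Z by (simp add: w_def pq_coeff_def pq_binomial_nonneg)
  have t01: "t k \<in> {0..1}" if "k \<in> {0..n}" for k
    unfolding t_def using that n PQ by (intro pq_node_in_unit_interval) auto
  show "\<bar>king_lupas n f (p n) (q n) x - f x\<bar>
      \<le> 2 * modulus_cont f (sqrt (king_lupas n (\<lambda>t. (t - x)\<^sup>2) (p n) (q n) x))"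
    unfolding eq using weighted_mean_approximation[OF f x t01 w0 w1] .
qed

end
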